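(* Let $(X_i,\mathsf d_i,\mu_i)$, $i=1,2$, be complete separable metric spaces with Borel probability measures of finite fourth moment, and let $X:=X_1\times X_2$ be equipped with the metric $\mathsf d(x,y):=\sqrt{\mathsf d_1^2(x_1,y_1)+\mathsf d_2^2(x_2,y_2)}$ for $x=(x_1,x_2)$, $y=(y_1,y_2)$, and with the product measure $\mu:=\mu_1\otimes\mu_2$. Let $M^{(i)}\colon X_i\to\ell^2$ be the infinite MDS map of $(X_i,\mathsf d_i,\mu_i)$, $i=1,2$. Then the infinite MDS map $M$ of $(X,\mathsf d,\mu)$ can be represented (for a suitable choice of eigenfunctions and up to the ordering of coordinates and insertion or deletion of zero coordinates) as \[ M\colon X\to\ell^2\times\ell^2,\qquad x\mapsto M(x)=(M^{(1)}(x_1),M^{(2)}(x_2)), \] where $\ell^2\times\ell^2$ is equipped with its natural Hilbert space structure, and \[ \|M(x)-M(y)\|_2^2=\|M^{(1)}(x_1)-M^{(1)}(y_1)\|_2^2+\|M^{(2)}(x_2)-M^{(2)}(y_2)\|_2^2 \] for $x=(x_1,x_2),\,y=(y_1,y_2)\in X$.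
   Context: For a complete separable metric space $(X,\mathsf d)$ with a Borel probability measure $\mu$ such that $\int_X\mathsf d^4(x_0,y)\,d\mu(y)<\infty$ for some $x_0$ (finite fourth moment), let $\mathsf k(x,y):=-\frac12\mathsf d^2(x,y)$, $(Kg)(x):=\int_X\mathsf k(x,y)g(y)\,d\mu(y)$, $Pg:=g-\int_Xg\,d\mu$ and $T:=PKP$ on $L^2(X,\mu)$; $T$ is a self-adjoint Hilbert--Schmidt operator. Let $\lambda_1^+(T)\ge\lambda_2^+(T)\ge\dots>0$ be its positive eigenvalues counted with multiplicity and $u_j^+(T)$ corresponding orthonormal eigenfunctions (identified with their continuous representatives). The infinite MDS map of $(X,\mathsf d,\mu)$ is $M(x):=(\sqrt{\lambda_j^+(T)}\,u_j^+(T)(x))_{j\ge1}$, extended by zeros if there are finitely many positive eigenvalues; it depends on the choice of the eigenfunctions. *)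

theory Defs
  imports "HOL-Probability.Probability"
begin

text \<open>Complete separable metric spaces are types of class \<open>polish_space\<close>.  The metric of the product
  type is the library's $\sqrt{d_1^2+d_2^2}$ (\<open>dist_Pair_Pair\<close>).\<close>

definition finite_fourth_moment :: "'a::metric_space measure \<Rightarrow> bool" where
  "finite_fourth_moment \<mu> \<longleftrightarrow> (\<exists>x0. integrable \<mu> (\<lambda>y. dist x0 y ^ 4))"

text \<open>Elements of $L^2(X,\mu)$ are represented by functions; equality in $L^2$ is
  equality almost everywhere and is spelled out where it is used.\<close>

definition L2 :: "'a measure \<Rightarrow> ('a \<Rightarrow> real) set" where
  "L2 \<mu> = {g \<in> borel_measurable \<mu>. integrable \<mu> (\<lambda>x. (g x)\<^sup>2)}"

definition mds_kernel :: "'a::metric_space \<Rightarrow> 'a \<Rightarrow> real" where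
  "mds_kernel x y = - (1/2) * (dist x y)\<^sup>2"

definition K_op :: "'a::metric_space measure \<Rightarrow> ('a \<Rightarrow> real) \<Rightarrow> 'a \<Rightarrow> real" where
  "K_op \<mu> g x = (\<integral>y. mds_kernel x y * g y \<partial>\<mu>)"

definition P_op :: "'a measure \<Rightarrow> ('a \<Rightarrow> real) \<Rightarrow> 'a \<Rightarrow> real" where
  "P_op \<mu> g x = g x - (\<integral>y. g y \<partial>\<mu>)"

definition T_op :: "'a::metric_space measure \<Rightarrow> ('a \<Rightarrow> real) \<Rightarrow> 'a \<Rightarrow> real" where
  "T_op \<mu> g = P_op \<mu> (K_op \<mu> (P_op \<mu> g))"

definition T_eigenspace :: "'a::metric_space measure \<Rightarrow> real \<Rightarrow> ('a \<Rightarrow> real) set" where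
  "T_eigenspace \<mu> c = {g \<in> L2 \<mu>. AE x in \<mu>. T_op \<mu> g x = c * g x}"

text \<open>The sequences \<open>l\<close> and \<open>u\<close> are meaningful at the indices \<open>j < n\<close> only, where
  \<open>n = \<infinity>\<close> if there are infinitely many positive eigenvalues.  The last clause says that for
  each \<open>c > 0\<close> the functions \<open>u j\<close> with \<open>l j = c\<close> span the whole eigenspace of \<open>c\<close>; being
  orthonormal, they form a basis of it, so every positive eigenvalue is listed exactly as often
  as its multiplicity.\<close>

definition positive_eigensystem ::
  "'a::metric_space measure \<Rightarrow> enat \<Rightarrow> (nat \<Rightarrow> real) \<Rightarrow> (nat \<Rightarrow> 'a \<Rightarrow> real) \<Rightarrow> bool" where
  "positive_eigensystem \<mu> n l u \<longleftrightarrow>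
     (\<forall>j. enat j < n \<longrightarrow>
        l j > 0 \<and> continuous_on UNIV (u j) \<and> u j \<in> T_eigenspace \<mu> (l j)) \<and>
     (\<forall>i j. i \<le> j \<and> enat j < n \<longrightarrow> l j \<le> l i) \<and>
     (\<forall>i j. enat i < n \<and> enat j < n \<longrightarrow>
        (\<integral>x. u i x * u j x \<partial>\<mu>) = (if i = j then 1 else 0)) \<and>
     (\<forall>c>0. \<forall>g\<in>T_eigenspace \<mu> c.
        \<exists>F a. finite F \<and> F \<subseteq> {j. enat j < n \<and> l j = c} \<and>
              (AE x in \<mu>. g x = (\<Sum>j\<in>F. a j * u j x)))"

text \<open>An infinite MDS map depends on the choice of the eigenfunctions, hence a predicate.
  Coordinates are numbered from 0.  The values are plain sequences, since their square
  summability is not automatic: the positive part of \<open>T\<close> need not be of trace class.\<close>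

definition is_mds_map :: "'a::metric_space measure \<Rightarrow> ('a \<Rightarrow> nat \<Rightarrow> real) \<Rightarrow> bool" where
  "is_mds_map \<mu> M \<longleftrightarrow>
     (\<exists>n l u. positive_eigensystem \<mu> n l u \<and>
        M = (\<lambda>x j. if enat j < n then sqrt (l j) * u j x else 0))"

definition ell2 :: "(nat \<Rightarrow> real) set" where
  "ell2 = {a. summable (\<lambda>j. (a j)\<^sup>2)}"

definition ell2_norm :: "(nat \<Rightarrow> real) \<Rightarrow> real" where
  "ell2_norm a = sqrt (\<Sum>j. (a j)\<^sup>2)"

text \<open>The norm of the Hilbert space direct sum of two copies of $\ell^2$.\<close>

definition ell2_prod_norm :: "(nat \<Rightarrow> real) \<times> (nat \<Rightarrow> real) \<Rightarrow> real" where
  "ell2_prod_norm p = sqrt ((ell2_norm (fst p))\<^sup>2 + (ell2_norm (snd p))\<^sup>2)"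

definition pair_coords :: "(nat \<Rightarrow> real) \<times> (nat \<Rightarrow> real) \<Rightarrow> nat + nat \<Rightarrow> real" where
  "pair_coords p = case_sum (fst p) (snd p)"

text \<open>Two maps into spaces of real families agree up to the ordering of coordinates and
  insertion or deletion of zero coordinates.  A zero coordinate is one that vanishes identically
  on the domain; the matching \<open>\<sigma>\<close> of the remaining coordinates does not depend on the point.\<close>

definition same_nonzero_coords ::
  "('x \<Rightarrow> 'i \<Rightarrow> real) \<Rightarrow> ('x \<Rightarrow> 'j \<Rightarrow> real) \<Rightarrow> bool" where
  "same_nonzero_coords f g \<longleftrightarrow>
     (\<exists>\<sigma>. bij_betw \<sigma> {i. \<exists>x. f x i \<noteq> 0} {j. \<exists>x. g x j \<noteq> 0} \<and>
          (\<forall>i. (\<exists>x. f x i \<noteq> 0) \<longrightarrow> (\<forall>x. g x (\<sigma> i) = f x i)))"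

end

theory Submission
  imports Defs
begin

text \<open>The kernel of the product is the sum of the two kernels, so \<open>T\<close> acts on \<open>g\<close> through its two
  marginals: \<open>T g (x\<^sub>1, x\<^sub>2) = T\<^sub>1 g\<^sub>1 x\<^sub>1 + T\<^sub>2 g\<^sub>2 x\<^sub>2\<close>, where \<open>g\<^sub>i\<close> arises from \<open>g\<close> by integrating out the
  other variable.  As \<open>T\<^sub>i\<close> has mean-zero range, integrating out one variable in \<open>T g = c g\<close> gives
  \<open>T\<^sub>i g\<^sub>i = c g\<^sub>i\<close>, and then \<open>g = g\<^sub>1 + g\<^sub>2\<close>.  Hence each eigenspace of \<open>T\<close> for \<open>c \<noteq> 0\<close> is the orthogonal
  sum of those of \<open>T\<^sub>1\<close> and \<open>T\<^sub>2\<close>.  Since the positive eigenvalues of \<open>T\<^sub>1\<close> and \<open>T\<^sub>2\<close> accumulate only at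
  \<open>0\<close>, the two lists can be merged into one decreasing list.\<close>

subsection \<open>Square integrable functions on products\<close>

lemma L2_mult_integrable:
  assumes "f \<in> L2 M" "g \<in> L2 M"
  shows "integrable M (\<lambda>x. f x * g x)"
proof (rule Bochner_Integration.integrable_bound)
  show "integrable M (\<lambda>x. (f x)\<^sup>2 + (g x)\<^sup>2)" using assms by (simp add: L2_def)
  show "(\<lambda>x. f x * g x) \<in> borel_measurable M" using assms by (auto simp: L2_def)
  have "\<bar>a * b\<bar> \<le> a\<^sup>2 + b\<^sup>2" for a b :: real
    using sum_squares_bound[of "\<bar>a\<bar>" "\<bar>b\<bar>"] abs_ge_zero[of "a * b"]
    unfolding power2_abs mult.assoc abs_mult[symmetric] by linarith
  then show "AE x in M. norm (f x * g x) \<le> norm ((f x)\<^sup>2 + (g x)\<^sup>2)" by simp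
qed

text \<open>The cross term in the square of the sum is integrable by
  \<open>L2_mult_integrable\<close>.\<close>

lemma L2_add:
  assumes "f \<in> L2 M" "g \<in> L2 M"
  shows "(\<lambda>x. f x + g x) \<in> L2 M"
  using assms L2_mult_integrable[OF assms] by (auto simp: L2_def power2_sum mult.assoc)

lemma L2_scale:
  assumes "f \<in> L2 M"
  shows "(\<lambda>x. c * f x) \<in> L2 M"
  using assms by (auto simp: L2_def power_mult_distrib)

lemma L2_diff:
  assumes "f \<in> L2 M" "g \<in> L2 M"
  shows "(\<lambda>x. f x - g x) \<in> L2 M"
  using L2_add[OF assms(1) L2_scale[OF assms(2), of "-1"]] by simp

lemma L2_sum:
  assumes "\<And>i. i \<in> F \<Longrightarrow> f i \<in> L2 M"
  shows "(\<lambda>x. \<Sum>i\<in>F. f i x) \<in> L2 M"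
  using assms
proof (induction F rule: infinite_finite_induct)
  case (insert i F)
  then show ?case using L2_add[of "f i" M "\<lambda>x. \<Sum>i\<in>F. f i x"] by simp
qed (simp_all add: L2_def)

text \<open>Expand the nonnegative integral of \<open>(k - s)\<^sup>2\<close>, where
  \<open>s\<close> is the orthogonal projection of \<open>k\<close> onto the span of the
  \<open>w i\<close>. It is applied below to the kernel as an element of L2 of the product of a
  space with itself.\<close>

lemma Bessel_inequality:
  assumes "finite F" and w: "\<And>i. i \<in> F \<Longrightarrow> w i \<in> L2 M" and k: "k \<in> L2 M"
    and on: "\<And>i j. i \<in> F \<Longrightarrow> j \<in> F \<Longrightarrow> (\<integral>x. w i x * w j x \<partial>M) = (if i = j then 1 else 0)"
  shows "(\<Sum>i\<in>F. (\<integral>x. k x * w i x \<partial>M)\<^sup>2) \<le> (\<integral>x. (k x)\<^sup>2 \<partial>M)"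
proof -
  define c where "c i = (\<integral>x. k x * w i x \<partial>M)" for i
  define s where "s x = (\<Sum>i\<in>F. c i * w i x)" for x
  have s: "s \<in> L2 M" unfolding s_def by (intro L2_sum L2_scale w)
  \<comment> \<open>Pairing with \<open>s\<close> is computed once for general \<open>f\<close>,
    then used with \<open>w i\<close>, with \<open>s\<close> itself and with
    \<open>k\<close>.\<close>
  have inner: "(\<integral>x. f x * s x \<partial>M) = (\<Sum>i\<in>F. c i * (\<integral>x. f x * w i x \<partial>M))" if "f \<in> L2 M" for f
  proof -
    have "(\<integral>x. f x * s x \<partial>M) = (\<integral>x. (\<Sum>i\<in>F. c i * (f x * w i x)) \<partial>M)"
      by (simp add: s_def sum_distrib_left mult.left_commute)
    also have "\<dots> = (\<Sum>i\<in>F. \<integral>x. c i * (f x * w i x) \<partial>M)"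
      using that w by (intro Bochner_Integration.integral_sum) (simp add: L2_mult_integrable)
    finally show ?thesis by simp
  qed
  \<comment> \<open>The projection has the same coefficients as \<open>k\<close>; hence the pairings
    of \<open>s\<close> with \<open>s\<close> and of \<open>k\<close> with \<open>s\<close>
    coincide.\<close>
  have "(\<integral>x. s x * w i x \<partial>M) = c i" if "i \<in> F" for i
  proof -
    have "(\<integral>x. s x * w i x \<partial>M) = (\<integral>x. w i x * s x \<partial>M)" by (simp add: mult.commute)
    also have "\<dots> = (\<Sum>j\<in>F. (if i = j then c j else 0))"
      using that by (auto simp: inner w on intro!: sum.cong)
    finally show ?thesis using that \<open>finite F\<close> by simp
  qed
  then have ss: "(\<integral>x. s x * s x \<partial>M) = (\<Sum>i\<in>F. (c i)\<^sup>2)"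
    by (simp add: inner s power2_eq_square)
  have ks: "(\<integral>x. k x * s x \<partial>M) = (\<Sum>i\<in>F. (c i)\<^sup>2)"
    by (simp add: inner k c_def[symmetric] power2_eq_square)
  have "0 \<le> (\<integral>x. (k x - s x)\<^sup>2 \<partial>M)" by simp
  also have "\<dots> = (\<integral>x. (k x)\<^sup>2 - 2 * (k x * s x) + s x * s x \<partial>M)"
    by (simp add: power2_eq_square algebra_simps)
  also have "\<dots> = (\<integral>x. (k x)\<^sup>2 \<partial>M) - 2 * (\<integral>x. k x * s x \<partial>M) + (\<integral>x. s x * s x \<partial>M)"
    using k L2_mult_integrable[OF k s] L2_mult_integrable[OF s s] by (simp add: L2_def)
  finally show ?thesis by (simp add: ss ks c_def)
qed

context prob_space
begin

lemma L2_const: "(\<lambda>_. c) \<in> L2 M"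
  by (simp add: L2_def)

lemma L2_integrable: "f \<in> L2 M \<Longrightarrow> integrable M f"
  unfolding L2_def by (auto intro: square_integrable_imp_integrable)

text \<open>The difference of the two sides is the variance of \<open>f\<close>.\<close>

lemma integral_square_le:
  assumes "f \<in> L2 M"
  shows "(\<integral>x. f x \<partial>M)\<^sup>2 \<le> (\<integral>x. (f x)\<^sup>2 \<partial>M)"
proof -
  have "0 \<le> (\<integral>x. (f x)\<^sup>2 \<partial>M) - (\<integral>x. f x \<partial>M)\<^sup>2"
    using variance_positive[of f] assms unfolding L2_def
    by (subst (asm) variance_eq) (auto intro: L2_integrable simp: L2_def)
  then show ?thesis by simp
qed

lemma P_op_L2: "g \<in> L2 M \<Longrightarrow> P_op M g \<in> L2 M"
  unfolding P_op_def[abs_def] by (intro L2_diff L2_const)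

lemma P_op_integrable: "integrable M g \<Longrightarrow> integrable M (P_op M g)"
  unfolding P_op_def[abs_def] by simp

lemma integral_P_op: "integrable M g \<Longrightarrow> (\<integral>x. P_op M g x \<partial>M) = 0"
  unfolding P_op_def by (simp add: prob_space)

lemma P_op_eq_self: "(\<integral>x. u x \<partial>M) = 0 \<Longrightarrow> P_op M u = u"
  by (rule ext) (simp add: P_op_def)

end

section \<open>Pullbacks, tensor products and marginals on a product of probability spaces\<close>

context pair_prob_space
begin

lemma distr_pair_snd: "distr (M1 \<Otimes>\<^sub>M M2) M2 snd = M2"
proof (rule measure_eqI)
  fix A assume A: "A \<in> sets (distr (M1 \<Otimes>\<^sub>M M2) M2 snd)"
  then have "emeasure (distr (M1 \<Otimes>\<^sub>M M2) M2 snd) A =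
      emeasure (M1 \<Otimes>\<^sub>M M2) (snd -` A \<inter> space (M1 \<Otimes>\<^sub>M M2))"
    by (simp add: emeasure_distr)
  also have "snd -` A \<inter> space (M1 \<Otimes>\<^sub>M M2) = space M1 \<times> A"
    using sets.sets_into_space[of A M2] A by (auto simp: space_pair_measure)
  also have "emeasure (M1 \<Otimes>\<^sub>M M2) (space M1 \<times> A) = emeasure M2 A"
    using A by (simp add: M2.emeasure_pair_measure_Times M1.emeasure_space_1)
  finally show "emeasure (distr (M1 \<Otimes>\<^sub>M M2) M2 snd) A = emeasure M2 A" .
qed simp

lemma AE_fst: "AE x in M1. Q x \<Longrightarrow> AE z in M1 \<Otimes>\<^sub>M M2. Q (fst z)"
  using AE_distrD[of fst "M1 \<Otimes>\<^sub>M M2" M1 Q] unfolding M2.distr_pair_fst by simp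

lemma AE_snd: "AE y in M2. Q y \<Longrightarrow> AE z in M1 \<Otimes>\<^sub>M M2. Q (snd z)"
  using AE_distrD[of snd "M1 \<Otimes>\<^sub>M M2" M2 Q] unfolding distr_pair_snd by simp

lemma integrable_comp_fst:
  fixes f :: "_ \<Rightarrow> real"
  shows "integrable M1 f \<Longrightarrow> integrable (M1 \<Otimes>\<^sub>M M2) (\<lambda>z. f (fst z))"
  by (rule integrable_distr[of fst "M1 \<Otimes>\<^sub>M M2" M1]) (simp_all add: M2.distr_pair_fst)

lemma integrable_comp_snd:
  fixes f :: "_ \<Rightarrow> real"
  shows "integrable M2 f \<Longrightarrow> integrable (M1 \<Otimes>\<^sub>M M2) (\<lambda>z. f (snd z))"
  by (rule integrable_distr[of snd "M1 \<Otimes>\<^sub>M M2" M2]) (simp_all add: distr_pair_snd)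

lemma integral_comp_fst:
  fixes f :: "_ \<Rightarrow> real"
  shows "f \<in> borel_measurable M1 \<Longrightarrow> (\<integral>z. f (fst z) \<partial>(M1 \<Otimes>\<^sub>M M2)) = (\<integral>x. f x \<partial>M1)"
  using integral_distr[of fst "M1 \<Otimes>\<^sub>M M2" M1 f] by (simp add: M2.distr_pair_fst)

lemma integral_comp_snd:
  fixes f :: "_ \<Rightarrow> real"
  shows "f \<in> borel_measurable M2 \<Longrightarrow> (\<integral>z. f (snd z) \<partial>(M1 \<Otimes>\<^sub>M M2)) = (\<integral>y. f y \<partial>M2)"
  using integral_distr[of snd "M1 \<Otimes>\<^sub>M M2" M2 f] by (simp add: distr_pair_snd)

lemma L2_comp_fst: "f \<in> L2 M1 \<Longrightarrow> (\<lambda>z. f (fst z)) \<in> L2 (M1 \<Otimes>\<^sub>M M2)"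
  using integrable_comp_fst[of "\<lambda>x. (f x)\<^sup>2"] by (auto simp: L2_def)

lemma L2_comp_snd: "f \<in> L2 M2 \<Longrightarrow> (\<lambda>z. f (snd z)) \<in> L2 (M1 \<Otimes>\<^sub>M M2)"
  using integrable_comp_snd[of "\<lambda>x. (f x)\<^sup>2"] by (auto simp: L2_def)

lemma integrable_tensor:
  fixes f g :: "_ \<Rightarrow> real"
  assumes "integrable M1 f" "integrable M2 g"
  shows "integrable (M1 \<Otimes>\<^sub>M M2) (\<lambda>z. f (fst z) * g (snd z))"
  by (rule Fubini_integrable) (use assms in \<open>simp_all add: abs_mult\<close>)

lemma integral_tensor:
  fixes f g :: "_ \<Rightarrow> real"
  assumes "integrable M1 f" "integrable M2 g"
  shows "(\<integral>z. f (fst z) * g (snd z) \<partial>(M1 \<Otimes>\<^sub>M M2)) = (\<integral>x. f x \<partial>M1) * (\<integral>y. g y \<partial>M2)"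
  using integral_fst'[OF integrable_tensor[OF assms]] by simp

lemma L2_tensor:
  assumes "f \<in> L2 M1" "g \<in> L2 M2"
  shows "(\<lambda>z. f (fst z) * g (snd z)) \<in> L2 (M1 \<Otimes>\<^sub>M M2)"
  using assms integrable_tensor[of "\<lambda>x. (f x)\<^sup>2" "\<lambda>y. (g y)\<^sup>2"]
  by (auto simp: L2_def power_mult_distrib)

lemma swapped: "pair_prob_space M2 M1" ..

lemma AE_swap:
  assumes "AE z in M1 \<Otimes>\<^sub>M M2. Q z"
  shows "AE z in M2 \<Otimes>\<^sub>M M1. Q (snd z, fst z)"
proof -
  have "AE z in M2 \<Otimes>\<^sub>M M1. Q (case z of (x, y) \<Rightarrow> (y, x))"
    using assms by (intro AE_distrD[OF measurable_pair_swap']) (subst distr_pair_swap[symmetric])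
  then show ?thesis by (simp add: case_prod_beta)
qed

lemma L2_swap:
  assumes "g \<in> L2 (M1 \<Otimes>\<^sub>M M2)"
  shows "(\<lambda>z. g (snd z, fst z)) \<in> L2 (M2 \<Otimes>\<^sub>M M1)"
  using assms measurable_pair_swap[of g M1 M2 borel] integrable_product_swap[of "\<lambda>z. (g z)\<^sup>2"]
  by (auto simp: L2_def case_prod_beta')

text \<open>On almost every fibre the squared mean of \<open>g\<close> is at most the mean of its
  square, and by Fubini the latter is an integrable function of \<open>x\<close>.\<close>

lemma L2_marginal_fst:
  assumes g: "g \<in> L2 (M1 \<Otimes>\<^sub>M M2)"
  shows "(\<lambda>x. \<integral>y. g (x, y) \<partial>M2) \<in> L2 M1"
proof -
  have [measurable]: "g \<in> borel_measurable (M1 \<Otimes>\<^sub>M M2)"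
    and i: "integrable (M1 \<Otimes>\<^sub>M M2) (\<lambda>z. (g z)\<^sup>2)" using g by (simp_all add: L2_def)
  have m: "(\<lambda>x. \<integral>y. g (x, y) \<partial>M2) \<in> borel_measurable M1"
    by (rule M2.borel_measurable_lebesgue_integral) simp
  have "integrable M1 (\<lambda>x. (\<integral>y. g (x, y) \<partial>M2)\<^sup>2)"
  proof (rule Bochner_Integration.integrable_bound[OF integrable_fst'[OF i]])
    show "(\<lambda>x. (\<integral>y. g (x, y) \<partial>M2)\<^sup>2) \<in> borel_measurable M1" using m by simp
    show "AE x in M1. norm ((\<integral>y. g (x, y) \<partial>M2)\<^sup>2) \<le> norm (\<integral>y. (g (x, y))\<^sup>2 \<partial>M2)"
      using AE_integrable_fst'[OF i] AE_space
    proof eventually_elim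
      case (elim x)
      then have "(\<lambda>y. g (x, y)) \<in> L2 M2" by (simp add: L2_def)
      then show ?case using M2.integral_square_le by force
    qed
  qed
  with m show ?thesis by (simp add: L2_def)
qed

lemma L2_marginal_snd:
  assumes "g \<in> L2 (M1 \<Otimes>\<^sub>M M2)"
  shows "(\<lambda>y. \<integral>x. g (x, y) \<partial>M1) \<in> L2 M2"
  using pair_prob_space.L2_marginal_fst[OF swapped L2_swap[OF assms]] by simp

lemma integral_mult_fst:
  assumes "f \<in> L2 M1" "h \<in> L2 (M1 \<Otimes>\<^sub>M M2)"
  shows "(\<integral>z. f (fst z) * h z \<partial>(M1 \<Otimes>\<^sub>M M2)) = (\<integral>x. f x * (\<integral>y. h (x, y) \<partial>M2) \<partial>M1)"
  using integral_fst'[OF L2_mult_integrable[OF L2_comp_fst[OF assms(1)] assms(2)]] by simp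

lemma integral_mult_snd:
  assumes "f \<in> L2 M2" "h \<in> L2 (M1 \<Otimes>\<^sub>M M2)"
  shows "(\<integral>z. f (snd z) * h z \<partial>(M1 \<Otimes>\<^sub>M M2)) = (\<integral>y. f y * (\<integral>x. h (x, y) \<partial>M1) \<partial>M2)"
  using integral_snd[of "\<lambda>x y. f y * h (x, y)"] L2_mult_integrable[OF L2_comp_snd[OF assms(1)] assms(2)]
  by (simp add: case_prod_beta')

text \<open>Only almost everywhere: on the null set of \<open>x\<close> whose fibre of
  \<open>g\<close> is not integrable, the fibre integrals take the default value 0 and do not split
  linearly.\<close>

lemma marginal_fst_P_op:
  assumes g: "g \<in> L2 (M1 \<Otimes>\<^sub>M M2)"
  shows "AE x in M1. (\<integral>y. P_op (M1 \<Otimes>\<^sub>M M2) g (x, y) \<partial>M2) = P_op M1 (\<lambda>x. \<integral>y. g (x, y) \<partial>M2) x"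
proof -
  have i: "integrable (M1 \<Otimes>\<^sub>M M2) g" using g by (rule P.L2_integrable)
  show ?thesis
    using AE_integrable_fst'[OF i]
    by eventually_elim (simp add: P_op_def M2.prob_space integral_fst'[OF i])
qed

lemma marginal_snd_P_op:
  assumes g: "g \<in> L2 (M1 \<Otimes>\<^sub>M M2)"
  shows "AE y in M2. (\<integral>x. P_op (M1 \<Otimes>\<^sub>M M2) g (x, y) \<partial>M1) = P_op M2 (\<lambda>y. \<integral>x. g (x, y) \<partial>M1) y"
proof -
  have i: "integrable (M1 \<Otimes>\<^sub>M M2) (\<lambda>(x, y). g (x, y))" using P.L2_integrable[OF g] by simp
  show ?thesis
    using AE_integrable_snd[OF i]
    by eventually_elim (use integral_snd[OF i] in \<open>simp add: P_op_def M1.prob_space\<close>)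
qed

end

subsection \<open>The spectrum of the operator\<close>

lemma positive_eigensystemD:
  assumes "positive_eigensystem \<mu> n l u"
  shows "\<And>j. enat j < n \<Longrightarrow> 0 < l j"
    and "\<And>j. enat j < n \<Longrightarrow> continuous_on UNIV (u j)"
    and "\<And>j. enat j < n \<Longrightarrow> u j \<in> T_eigenspace \<mu> (l j)"
    and "\<And>i j. enat i < n \<Longrightarrow> enat j < n \<Longrightarrow> (\<integral>x. u i x * u j x \<partial>\<mu>) = (if i = j then 1 else 0)"
    and "\<And>c g. 0 < c \<Longrightarrow> g \<in> T_eigenspace \<mu> c \<Longrightarrow>
      \<exists>F a. finite F \<and> F \<subseteq> {j. enat j < n \<and> l j = c} \<and> (AE x in \<mu>. g x = (\<Sum>j\<in>F. a j * u j x))"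
  using assms unfolding positive_eigensystem_def by simp_all

locale fourth_moment_space = prob_space \<mu>
  for \<mu> :: "'a::polish_space measure" +
  assumes sets_eq_borel [measurable_cong]: "sets \<mu> = sets borel"
    and fourth_moment: "finite_fourth_moment \<mu>"
begin

sublocale sq: pair_prob_space \<mu> \<mu> ..

text \<open>The triangle inequality, followed by two uses of
  \<open>(a + b)\<^sup>2 \<le> 2 * (a\<^sup>2 + b\<^sup>2)\<close>. It transfers the moment at one
  base point to every base point and to the product measure.\<close>

lemma dist_power4_bound: "dist x y ^ 4 \<le> 8 * dist x0 x ^ 4 + 8 * dist x0 (y :: 'a) ^ 4"
proof -
  have "dist x y \<le> dist x0 x + dist x0 y"
    using dist_triangle[of x y x0] by (simp add: dist_commute)
  then have "(dist x y) ^ 4 \<le> (dist x0 x + dist x0 y) ^ 4" by (intro power_mono) auto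
  also have "\<dots> = ((dist x0 x + dist x0 y)\<^sup>2)\<^sup>2" by (simp flip: power_mult)
  also have "\<dots> \<le> (2 * ((dist x0 x)\<^sup>2 + (dist x0 y)\<^sup>2))\<^sup>2"
    using sum_squares_bound[of "dist x0 x" "dist x0 y"] by (intro power_mono) (auto simp: power2_sum)
  also have "\<dots> = 4 * ((dist x0 x)\<^sup>2 + (dist x0 y)\<^sup>2)\<^sup>2" by (simp only: power_mult_distrib) simp
  also have "\<dots> \<le> 4 * (2 * (((dist x0 x)\<^sup>2)\<^sup>2 + ((dist x0 y)\<^sup>2)\<^sup>2))"
    using sum_squares_bound[of "(dist x0 x)\<^sup>2" "(dist x0 y)\<^sup>2"] by (intro mult_left_mono) (auto simp: power2_sum)
  finally show ?thesis by (simp flip: power_mult)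
qed

lemma mds_kernel_square: "(mds_kernel x y)\<^sup>2 = (1/4) * (dist x y) ^ 4"
  by (simp add: mds_kernel_def power2_eq_square power4_eq_xxxx)

lemma kernel_section_L2: "mds_kernel x \<in> L2 \<mu>"
proof -
  obtain x0 where x0: "integrable \<mu> (\<lambda>y. dist x0 y ^ 4)"
    using fourth_moment by (auto simp: finite_fourth_moment_def)
  have "integrable \<mu> (\<lambda>y. 8 * dist x0 x ^ 4 + 8 * dist x0 y ^ 4)" using x0 by simp
  then have "integrable \<mu> (\<lambda>y. dist x y ^ 4)"
    by (rule Bochner_Integration.integrable_bound) (use dist_power4_bound in \<open>simp_all add: distrib_left\<close>)
  moreover have "mds_kernel x \<in> borel_measurable \<mu>"
    unfolding mds_kernel_def[abs_def] by measurable
  ultimately show ?thesis by (simp add: L2_def mds_kernel_square)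
qed

text \<open>This is the Hilbert-Schmidt property of \<open>K_op\<close>, the source of all control
  on the eigenvalues.\<close>

lemma kernel_L2: "(\<lambda>z. mds_kernel (fst z) (snd z)) \<in> L2 (\<mu> \<Otimes>\<^sub>M \<mu>)"
proof -
  obtain x0 where x0: "integrable \<mu> (\<lambda>y. dist x0 y ^ 4)"
    using fourth_moment by (auto simp: finite_fourth_moment_def)
  have "integrable (\<mu> \<Otimes>\<^sub>M \<mu>) (\<lambda>z. 8 * dist x0 (fst z) ^ 4 + 8 * dist x0 (snd z) ^ 4)"
    using sq.integrable_comp_fst[OF x0] sq.integrable_comp_snd[OF x0] by simp
  then have "integrable (\<mu> \<Otimes>\<^sub>M \<mu>) (\<lambda>z. dist (fst z) (snd z) ^ 4)"
    by (rule Bochner_Integration.integrable_bound) (use dist_power4_bound in \<open>simp_all add: distrib_left\<close>)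
  moreover have "(\<lambda>z. mds_kernel (fst z) (snd z)) \<in> borel_measurable (\<mu> \<Otimes>\<^sub>M \<mu>)"
    unfolding mds_kernel_def by measurable
  ultimately show ?thesis by (simp add: L2_def mds_kernel_square)
qed

text \<open>Integration against a kernel section ignores null sets at each point \<open>x\<close>,
  so almost everywhere equal inputs give outputs equal everywhere.\<close>

lemma K_op_cong_AE:
  assumes "f \<in> L2 \<mu>" "g \<in> L2 \<mu>" "AE x in \<mu>. f x = g x"
  shows "K_op \<mu> f = K_op \<mu> g"
proof
  fix x
  have "mds_kernel x \<in> borel_measurable \<mu>" using kernel_section_L2 by (simp add: L2_def)
  then show "K_op \<mu> f x = K_op \<mu> g x"
    unfolding K_op_def using assms by (intro integral_cong_AE) (auto simp: L2_def)
qed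

text \<open>Fubini for the kernel times the pullback of \<open>g\<close>. Integrability is enough
  here, since the outer projection only needs the mean of \<open>K_op \<mu> g\<close>.\<close>

lemma K_op_integrable:
  assumes "g \<in> L2 \<mu>"
  shows "integrable \<mu> (K_op \<mu> g)"
  using sq.integrable_fst'[OF L2_mult_integrable[OF kernel_L2 sq.L2_comp_snd[OF assms]]]
  by (simp add: K_op_def[abs_def])

lemma T_op_integrable: "g \<in> L2 \<mu> \<Longrightarrow> integrable \<mu> (T_op \<mu> g)"
  unfolding T_op_def by (intro P_op_integrable K_op_integrable P_op_L2)

lemma integral_T_op: "g \<in> L2 \<mu> \<Longrightarrow> (\<integral>x. T_op \<mu> g x \<partial>\<mu>) = 0"
  unfolding T_op_def by (intro integral_P_op K_op_integrable P_op_L2)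

text \<open>The inner projection annihilates constants. This is why a function of one variable is
  invisible to the operator of the other factor.\<close>

lemma T_op_const: "T_op \<mu> (\<lambda>_. c) = (\<lambda>_. 0)"
  by (simp add: T_op_def P_op_def[abs_def] K_op_def[abs_def] prob_space)

text \<open>The outer projection gives the operator a mean-zero range; integrate the eigenvalue
  equation and divide by \<open>c\<close>.\<close>

lemma eigenfunction_mean_zero:
  assumes u: "u \<in> T_eigenspace \<mu> c" and "c \<noteq> 0"
  shows "(\<integral>x. u x \<partial>\<mu>) = 0"
proof -
  have L2: "u \<in> L2 \<mu>" and eq: "AE x in \<mu>. T_op \<mu> u x = c * u x"
    using u by (simp_all add: T_eigenspace_def)
  have "(\<integral>x. T_op \<mu> u x \<partial>\<mu>) = (\<integral>x. c * u x \<partial>\<mu>)"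
    using eq T_op_integrable[OF L2] L2_integrable[OF L2] by (intro integral_cong_AE) auto
  with integral_T_op[OF L2] \<open>c \<noteq> 0\<close> show ?thesis by simp
qed

text \<open>The eigenvalue of a normalised eigenfunction \<open>u\<close> is the coefficient of the kernel along
  \<open>u \<otimes> u\<close>, so Bessel's inequality on \<open>\<mu> \<otimes> \<mu>\<close> bounds the sum of the squared eigenvalues.\<close>

lemma eigenvalue_eq_kernel_coefficient:
  assumes u: "u \<in> T_eigenspace \<mu> c" and "c \<noteq> 0" and norm: "(\<integral>x. u x * u x \<partial>\<mu>) = 1"
  shows "(\<integral>z. mds_kernel (fst z) (snd z) * (u (fst z) * u (snd z)) \<partial>(\<mu> \<Otimes>\<^sub>M \<mu>)) = c"
proof -
  have L2: "u \<in> L2 \<mu>" and eq: "AE x in \<mu>. T_op \<mu> u x = c * u x"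
    using u by (simp_all add: T_eigenspace_def)
  have mean: "(\<integral>x. u x \<partial>\<mu>) = 0" by (rule eigenfunction_mean_zero) fact+
  define m where "m = (\<integral>x. K_op \<mu> u x \<partial>\<mu>)"
  have T: "T_op \<mu> u x = K_op \<mu> u x - m" for x
    by (simp add: T_op_def P_op_eq_self[OF mean] m_def P_op_def)
  have ker: "integrable (\<mu> \<Otimes>\<^sub>M \<mu>) (\<lambda>z. mds_kernel (fst z) (snd z) * (u (fst z) * u (snd z)))"
    by (intro L2_mult_integrable kernel_L2 sq.L2_tensor L2)
  have inner: "(\<integral>y. mds_kernel x y * (u x * u y) \<partial>\<mu>) = u x * K_op \<mu> u x" for x
    by (simp add: K_op_def mult.left_commute)
  have uK: "integrable \<mu> (\<lambda>x. u x * K_op \<mu> u x)"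
    using sq.integrable_fst'[OF ker] by (simp add: inner)
  have "(\<integral>z. mds_kernel (fst z) (snd z) * (u (fst z) * u (snd z)) \<partial>(\<mu> \<Otimes>\<^sub>M \<mu>)) =
      (\<integral>x. u x * K_op \<mu> u x \<partial>\<mu>)"
    using sq.integral_fst'[OF ker] by (simp add: inner)
  \<comment> \<open>Since \<open>u\<close> has mean zero, subtracting \<open>m * u\<close> changes
    nothing and turns \<open>K_op \<mu> u\<close> into \<open>T_op \<mu> u\<close>.\<close>
  also have "\<dots> = (\<integral>x. u x * K_op \<mu> u x - m * u x \<partial>\<mu>)"
    using uK L2_integrable[OF L2] mean by simp
  also have "\<dots> = (\<integral>x. c * (u x * u x) \<partial>\<mu>)"
  proof (rule integral_cong_AE)
    show "AE x in \<mu>. u x * K_op \<mu> u x - m * u x = c * (u x * u x)"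
      using eq by eventually_elim (auto simp: T algebra_simps)
  qed (use uK L2_integrable[OF L2] in auto)
  finally show ?thesis using norm by simp
qed

text \<open>Needed for the merging: if infinitely many eigenvalues of one factor stayed above an
  eigenvalue of the other, no decreasing enumeration by natural numbers could reach the
  latter.\<close>

lemma finite_large_eigenvalues:
  assumes sys: "positive_eigensystem \<mu> n l u" and "c > 0"
  shows "finite {j. enat j < n \<and> c \<le> l j}"
proof (rule ccontr)
  define A where "A = (\<integral>z. (mds_kernel (fst z) (snd z))\<^sup>2 \<partial>(\<mu> \<Otimes>\<^sub>M \<mu>))"
  \<comment> \<open>\<open>A\<close> is the squared Hilbert-Schmidt norm of \<open>K_op\<close>;
    more than \<open>A / c\<^sup>2\<close> eigenvalues of size at least \<open>c\<close> will
    violate Bessel's inequality.\<close>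
  obtain N where N: "A / c\<^sup>2 < real N" using reals_Archimedean2 by blast
  assume "infinite {j. enat j < n \<and> c \<le> l j}"
  then obtain F where F: "finite F" "card F = N" "F \<subseteq> {j. enat j < n \<and> c \<le> l j}"
    using infinite_arbitrarily_large by blast
  have l: "0 < l j" and u: "u j \<in> T_eigenspace \<mu> (l j)" if "j \<in> F" for j
    using that F(3) positive_eigensystemD(1,3)[OF sys] by auto
  have on: "(\<integral>x. u i x * u j x \<partial>\<mu>) = (if i = j then 1 else 0)" if "i \<in> F" "j \<in> F" for i j
    by (rule positive_eigensystemD(4)[OF sys]) (use that F(3) in auto)
  have L2: "u j \<in> L2 \<mu>" if "j \<in> F" for j using u[OF that] by (simp add: T_eigenspace_def)
  define w where "w j z = u j (fst z) * u j (snd z)" for j and z :: "'a \<times> 'a"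
  have "(\<Sum>j\<in>F. (l j)\<^sup>2) = (\<Sum>j\<in>F. (\<integral>z. mds_kernel (fst z) (snd z) * w j z \<partial>(\<mu> \<Otimes>\<^sub>M \<mu>))\<^sup>2)"
  proof (rule sum.cong[OF refl])
    fix j assume j: "j \<in> F"
    have "(\<integral>z. mds_kernel (fst z) (snd z) * w j z \<partial>(\<mu> \<Otimes>\<^sub>M \<mu>)) = l j"
      unfolding w_def
      by (rule eigenvalue_eq_kernel_coefficient) (use u[OF j] l[OF j] on[OF j j] in auto)
    then show "(l j)\<^sup>2 = (\<integral>z. mds_kernel (fst z) (snd z) * w j z \<partial>(\<mu> \<Otimes>\<^sub>M \<mu>))\<^sup>2" by simp
  qed
  also have "\<dots> \<le> A"
    unfolding A_def
  proof (rule Bessel_inequality[OF F(1) _ kernel_L2])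
    show "w j \<in> L2 (\<mu> \<Otimes>\<^sub>M \<mu>)" if "j \<in> F" for j
      unfolding w_def[abs_def] by (intro sq.L2_tensor L2 that)
    \<comment> \<open>The inner product of two tensor squares is the square of the inner product of
      the factors, and 0 and 1 are their own squares.\<close>
    fix i j assume ij: "i \<in> F" "j \<in> F"
    have "(\<integral>z. w i z * w j z \<partial>(\<mu> \<Otimes>\<^sub>M \<mu>)) =
        (\<integral>z. (u i (fst z) * u j (fst z)) * (u i (snd z) * u j (snd z)) \<partial>(\<mu> \<Otimes>\<^sub>M \<mu>))"
      by (simp add: w_def mult_ac)
    also have "\<dots> = (\<integral>x. u i x * u j x \<partial>\<mu>) * (\<integral>x. u i x * u j x \<partial>\<mu>)"
      by (rule sq.integral_tensor) (use ij in \<open>auto intro!: L2_mult_integrable L2\<close>)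
    finally show "(\<integral>z. w i z * w j z \<partial>(\<mu> \<Otimes>\<^sub>M \<mu>)) = (if i = j then 1 else 0)"
      using on[OF ij] by simp
  qed
  finally have "(\<Sum>j\<in>F. (l j)\<^sup>2) \<le> A" .
  moreover have "(\<Sum>j\<in>F. c\<^sup>2) \<le> (\<Sum>j\<in>F. (l j)\<^sup>2)"
    using F(3) \<open>c > 0\<close> by (intro sum_mono power_mono) auto
  ultimately have "real N * c\<^sup>2 \<le> A" using F(2) by simp
  with N \<open>c > 0\<close> show False by (simp add: field_simps)
qed

end

section \<open>The operator on a product space and its eigenspaces\<close>

locale fourth_moment_pair = A: fourth_moment_space \<mu>1 + B: fourth_moment_space \<mu>2
  for \<mu>1 :: "'a::polish_space measure" and \<mu>2 :: "'b::polish_space measure"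
begin

sublocale pair_prob_space \<mu>1 \<mu>2 ..

lemma mds_kernel_pair: "mds_kernel x y = mds_kernel (fst x) (fst y) + mds_kernel (snd x) (snd y)"
  by (simp add: mds_kernel_def dist_prod_def field_simps)

text \<open>On L2 this represents the orthogonal projection onto the functions of the first
  variable, that is, the conditional expectation given that variable.\<close>

definition marginal1 :: "('a \<times> 'b \<Rightarrow> real) \<Rightarrow> 'a \<Rightarrow> real" where
  "marginal1 g x = (\<integral>y. g (x, y) \<partial>\<mu>2)"

definition marginal2 :: "('a \<times> 'b \<Rightarrow> real) \<Rightarrow> 'b \<Rightarrow> real" where
  "marginal2 g y = (\<integral>x. g (x, y) \<partial>\<mu>1)"

lemma marginal1_L2: "g \<in> L2 (\<mu>1 \<Otimes>\<^sub>M \<mu>2) \<Longrightarrow> marginal1 g \<in> L2 \<mu>1"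
  unfolding marginal1_def[abs_def] by (rule L2_marginal_fst)

lemma marginal2_L2: "g \<in> L2 (\<mu>1 \<Otimes>\<^sub>M \<mu>2) \<Longrightarrow> marginal2 g \<in> L2 \<mu>2"
  unfolding marginal2_def[abs_def] by (rule L2_marginal_snd)

text \<open>Each summand of the kernel involves one variable of \<open>y\<close> only, so Fubini
  moves the integration over the other variable onto \<open>h\<close>. Kernel sections are square
  integrable at every point, hence no exceptional set of \<open>x\<close>.\<close>

lemma K_op_pair:
  assumes h: "h \<in> L2 (\<mu>1 \<Otimes>\<^sub>M \<mu>2)"
  shows "K_op (\<mu>1 \<Otimes>\<^sub>M \<mu>2) h x = K_op \<mu>1 (marginal1 h) (fst x) + K_op \<mu>2 (marginal2 h) (snd x)"
proof -
  have "K_op (\<mu>1 \<Otimes>\<^sub>M \<mu>2) h x =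
      (\<integral>y. mds_kernel (fst x) (fst y) * h y + mds_kernel (snd x) (snd y) * h y \<partial>(\<mu>1 \<Otimes>\<^sub>M \<mu>2))"
    by (simp add: K_op_def mds_kernel_pair distrib_right)
  also have "\<dots> = (\<integral>y. mds_kernel (fst x) (fst y) * h y \<partial>(\<mu>1 \<Otimes>\<^sub>M \<mu>2)) +
      (\<integral>y. mds_kernel (snd x) (snd y) * h y \<partial>(\<mu>1 \<Otimes>\<^sub>M \<mu>2))"
    by (intro Bochner_Integration.integral_add L2_mult_integrable h L2_comp_fst L2_comp_snd
        A.kernel_section_L2 B.kernel_section_L2)
  finally show ?thesis
    by (simp add: K_op_def marginal1_def marginal2_def h integral_mult_fst integral_mult_snd
        A.kernel_section_L2 B.kernel_section_L2)
qed

text \<open>Projection and marginals commute almost everywhere only, but \<open>K_op\<close> does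
  not see null sets, so the identity holds at every \<open>x\<close>.\<close>

lemma K_op_P_op_pair:
  assumes g: "g \<in> L2 (\<mu>1 \<Otimes>\<^sub>M \<mu>2)"
  shows "K_op (\<mu>1 \<Otimes>\<^sub>M \<mu>2) (P_op (\<mu>1 \<Otimes>\<^sub>M \<mu>2) g) x =
    K_op \<mu>1 (P_op \<mu>1 (marginal1 g)) (fst x) + K_op \<mu>2 (P_op \<mu>2 (marginal2 g)) (snd x)"
proof -
  have h: "P_op (\<mu>1 \<Otimes>\<^sub>M \<mu>2) g \<in> L2 (\<mu>1 \<Otimes>\<^sub>M \<mu>2)" by (rule P.P_op_L2[OF g])
  have "K_op \<mu>1 (marginal1 (P_op (\<mu>1 \<Otimes>\<^sub>M \<mu>2) g)) = K_op \<mu>1 (P_op \<mu>1 (marginal1 g))"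
    using marginal_fst_P_op[OF g]
    by (intro A.K_op_cong_AE marginal1_L2 A.P_op_L2 g h) (simp add: marginal1_def[abs_def])
  moreover have "K_op \<mu>2 (marginal2 (P_op (\<mu>1 \<Otimes>\<^sub>M \<mu>2) g)) = K_op \<mu>2 (P_op \<mu>2 (marginal2 g))"
    using marginal_snd_P_op[OF g]
    by (intro B.K_op_cong_AE marginal2_L2 B.P_op_L2 g h) (simp add: marginal2_def[abs_def])
  ultimately show ?thesis by (simp add: K_op_pair h)
qed

lemma T_op_pair:
  assumes g: "g \<in> L2 (\<mu>1 \<Otimes>\<^sub>M \<mu>2)"
  shows "T_op (\<mu>1 \<Otimes>\<^sub>M \<mu>2) g x = T_op \<mu>1 (marginal1 g) (fst x) + T_op \<mu>2 (marginal2 g) (snd x)"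
proof -
  let ?a = "K_op \<mu>1 (P_op \<mu>1 (marginal1 g))" and ?b = "K_op \<mu>2 (P_op \<mu>2 (marginal2 g))"
  have a: "integrable \<mu>1 ?a" and b: "integrable \<mu>2 ?b"
    by (intro A.K_op_integrable A.P_op_L2 marginal1_L2 g)
      (intro B.K_op_integrable B.P_op_L2 marginal2_L2 g)
  \<comment> \<open>The mean of the sum is the sum of the two means, so the outer projection on the
    product acts on each summand as that of its own factor.\<close>
  have "(\<integral>z. ?a (fst z) + ?b (snd z) \<partial>(\<mu>1 \<Otimes>\<^sub>M \<mu>2)) = (\<integral>x. ?a x \<partial>\<mu>1) + (\<integral>y. ?b y \<partial>\<mu>2)"
    using a b by (simp add: integrable_comp_fst integrable_comp_snd integral_comp_fst integral_comp_snd)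
  then show ?thesis
    by (simp add: T_op_def P_op_def[of "\<mu>1 \<Otimes>\<^sub>M \<mu>2" "K_op _ _"] K_op_P_op_pair[OF g])
      (simp add: P_op_def)
qed

text \<open>The marginals of the pullback are \<open>u\<close> and a constant, and the second
  operator kills constants.\<close>

lemma eigenfunction_comp_fst:
  assumes u: "u \<in> T_eigenspace \<mu>1 c"
  shows "(\<lambda>z. u (fst z)) \<in> T_eigenspace (\<mu>1 \<Otimes>\<^sub>M \<mu>2) c"
proof -
  have L2: "u \<in> L2 \<mu>1" and eq: "AE x in \<mu>1. T_op \<mu>1 u x = c * u x"
    using u by (simp_all add: T_eigenspace_def)
  have m: "marginal1 (\<lambda>z. u (fst z)) = u" "marginal2 (\<lambda>z. u (fst z)) = (\<lambda>_. \<integral>x. u x \<partial>\<mu>1)"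
    by (simp_all add: marginal1_def[abs_def] marginal2_def[abs_def] B.prob_space)
  show ?thesis
    using AE_fst[OF eq] L2_comp_fst[OF L2]
    by (simp add: T_eigenspace_def T_op_pair m B.T_op_const)
qed

lemma eigenfunction_comp_snd:
  assumes u: "u \<in> T_eigenspace \<mu>2 c"
  shows "(\<lambda>z. u (snd z)) \<in> T_eigenspace (\<mu>1 \<Otimes>\<^sub>M \<mu>2) c"
proof -
  have L2: "u \<in> L2 \<mu>2" and eq: "AE x in \<mu>2. T_op \<mu>2 u x = c * u x"
    using u by (simp_all add: T_eigenspace_def)
  have m: "marginal2 (\<lambda>z. u (snd z)) = u" "marginal1 (\<lambda>z. u (snd z)) = (\<lambda>_. \<integral>x. u x \<partial>\<mu>2)"
    by (simp_all add: marginal1_def[abs_def] marginal2_def[abs_def] A.prob_space)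
  show ?thesis
    using AE_snd[OF eq] L2_comp_snd[OF L2]
    by (simp add: T_eigenspace_def T_op_pair m A.T_op_const)
qed

lemma eigenfunction_decomposition:
  assumes g: "g \<in> T_eigenspace (\<mu>1 \<Otimes>\<^sub>M \<mu>2) c" and "c \<noteq> 0"
  shows "marginal1 g \<in> T_eigenspace \<mu>1 c" and "marginal2 g \<in> T_eigenspace \<mu>2 c"
    and "AE z in \<mu>1 \<Otimes>\<^sub>M \<mu>2. g z = marginal1 g (fst z) + marginal2 g (snd z)"
proof -
  have L2: "g \<in> L2 (\<mu>1 \<Otimes>\<^sub>M \<mu>2)" using g by (simp add: T_eigenspace_def)
  have gm [measurable]: "g \<in> borel_measurable (\<mu>1 \<Otimes>\<^sub>M \<mu>2)" using L2 by (simp add: L2_def)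
  let ?s = "T_op \<mu>1 (marginal1 g)" and ?t = "T_op \<mu>2 (marginal2 g)"
  have s: "integrable \<mu>1 ?s" "(\<integral>x. ?s x \<partial>\<mu>1) = 0"
    using A.T_op_integrable A.integral_T_op marginal1_L2[OF L2] by auto
  have t: "integrable \<mu>2 ?t" "(\<integral>y. ?t y \<partial>\<mu>2) = 0"
    using B.T_op_integrable B.integral_T_op marginal2_L2[OF L2] by auto
  have eq: "AE z in \<mu>1 \<Otimes>\<^sub>M \<mu>2. ?s (fst z) + ?t (snd z) = c * g z"
    using g by (simp add: T_eigenspace_def T_op_pair[OF L2])
  \<comment> \<open>For almost every \<open>x\<close> the equation \<open>eq\<close> holds for
    almost every \<open>y\<close>, so it may be integrated over \<open>y\<close>; there
    \<open>?t\<close> contributes its mean, zero.\<close>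
  have e1: "AE x in \<mu>1. ?s x = c * marginal1 g x"
    using AE_pair[OF eq] AE_space
  proof eventually_elim
    case (elim x)
    have "(\<integral>y. ?s x + ?t y \<partial>\<mu>2) = (\<integral>y. c * g (x, y) \<partial>\<mu>2)"
      using elim t(1) by (intro integral_cong_AE) auto
    then show ?case using t by (simp add: marginal1_def B.prob_space)
  qed
  interpret swap: pair_prob_space \<mu>2 \<mu>1 by (rule swapped)
  have e2: "AE y in \<mu>2. ?t y = c * marginal2 g y"
    using swap.AE_pair[OF AE_swap[OF eq]] AE_space
  proof eventually_elim
    case (elim y)
    have "(\<integral>x. ?s x + ?t y \<partial>\<mu>1) = (\<integral>x. c * g (x, y) \<partial>\<mu>1)"
      using elim s(1) by (intro integral_cong_AE) auto
    then show ?case using s by (simp add: marginal2_def A.prob_space)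
  qed
  show "marginal1 g \<in> T_eigenspace \<mu>1 c" "marginal2 g \<in> T_eigenspace \<mu>2 c"
    using e1 e2 marginal1_L2[OF L2] marginal2_L2[OF L2] by (simp_all add: T_eigenspace_def)
  show "AE z in \<mu>1 \<Otimes>\<^sub>M \<mu>2. g z = marginal1 g (fst z) + marginal2 g (snd z)"
    \<comment> \<open>Substituting both marginal equations back into \<open>eq\<close> leaves
      \<open>c\<close> times the claim.\<close>
    using eq AE_fst[OF e1] AE_snd[OF e2]
  proof eventually_elim
    case (elim z)
    then have "c * g z = c * (marginal1 g (fst z) + marginal2 g (snd z))"
      by (simp add: distrib_left)
    with \<open>c \<noteq> 0\<close> show ?case by simp
  qed
qed

end

subsection \<open>Matching of coordinates\<close>

lemma enumerate_by_weight:
  fixes w :: "'i::countable \<Rightarrow> real"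
  assumes pos: "\<And>a. a \<in> J \<Longrightarrow> w a > 0"
    and fin: "\<And>c. c > 0 \<Longrightarrow> finite {a \<in> J. c \<le> w a}"
  obtains n \<sigma> where "bij_betw \<sigma> {j. enat j < n} J"
    and "\<forall>i j. i \<le> j \<and> enat j < n \<longrightarrow> w (\<sigma> j) \<le> w (\<sigma> i)"
proof -
  \<comment> \<open>Decreasing weight with ties broken by a numbering of the index type; an index has finitely many
    predecessors, and their number is its position.\<close>
  define before where
    "before b a \<longleftrightarrow> w a < w b \<or> w b = w a \<and> to_nat b < to_nat a" for a b
  define below where "below a = {b \<in> J. before b a}" for a
  define rank where "rank a = card (below a)" for a
  \<comment> \<open>Every predecessor of \<open>a\<close> weighs at least \<open>w a\<close>, so
    \<open>fin\<close> applies with the positive threshold \<open>w a\<close>.\<close>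
  have fin_below: "finite (below a)" if "a \<in> J" for a
    by (rule finite_subset[OF _ fin[OF pos[OF that]]]) (auto simp: below_def before_def)
  have total: "before a b \<or> before b a" if "a \<noteq> b" for a b
    using that by (auto simp: before_def) (metis linorder_neqE_nat to_nat_split)
  have rank_less: "rank a < rank b" if "a \<in> J" "b \<in> J" "before a b" for a b
    unfolding rank_def using that
    by (intro psubset_card_mono fin_below) (auto simp: below_def before_def)
  have inj: "inj_on rank J"
    using total rank_less by (metis inj_onI less_irrefl)
  \<comment> \<open>The ranks have no gaps: the predecessor \<open>b\<close> of \<open>a\<close>
    with the largest rank has all other predecessors of \<open>a\<close> below it, so its rank is
    exactly one less.\<close>
  have pred: "m \<in> rank ` J" if m: "Suc m \<in> rank ` J" for m
  proof -
    obtain a where a: "a \<in> J" "rank a = Suc m" using m by auto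
    have ne: "below a \<noteq> {}" using a by (auto simp: rank_def)
    have "Max (rank ` below a) \<in> rank ` below a"
      using ne fin_below[OF a(1)] by (intro Max_in) auto
    then obtain b where b: "b \<in> below a" "rank b = Max (rank ` below a)" by force
    have bJ: "b \<in> J" using b by (simp add: below_def)
    have "below b = below a - {b}"
    proof
      show "below b \<subseteq> below a - {b}" using b by (auto simp: below_def before_def)
      show "below a - {b} \<subseteq> below b"
      proof
        fix c assume c: "c \<in> below a - {b}"
        then have "rank c \<le> rank b" using b(2) fin_below[OF a(1)] by simp
        with c bJ total[of b c] rank_less[of b c] show "c \<in> below b"
          by (auto simp: below_def)
      qed
    qed
    then have "rank b = m" using a b fin_below[OF a(1)] by (simp add: rank_def)
    with bJ show ?thesis by auto
  qed
  have down: "i \<in> rank ` J" if "i \<le> j" "j \<in> rank ` J" for i j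
    using that by (induction rule: inc_induct) (use pred in auto)
  \<comment> \<open>A downward closed set of naturals is either everything or the initial segment
    below its least missing element.\<close>
  obtain n where n: "rank ` J = {j. enat j < n}"
  proof (cases "rank ` J = UNIV")
    case True
    then show ?thesis using that[of \<infinity>] by simp
  next
    case False
    define k where "k = (LEAST k. k \<notin> rank ` J)"
    have "\<exists>k. k \<notin> rank ` J" using False by blast
    then have "k \<notin> rank ` J" unfolding k_def by (rule LeastI_ex)
    moreover have "j \<in> rank ` J" if "j < k" for j
      using not_less_Least[of j "\<lambda>k. k \<notin> rank ` J"] that by (auto simp: k_def)
    ultimately have "rank ` J = {j. enat j < enat k}"
      using down[of k] by (force simp: linorder_not_le)
    then show ?thesis by (rule that)
  qed
  define \<sigma> where "\<sigma> = inv_into J rank"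
  have "bij_betw \<sigma> (rank ` J) J"
    unfolding \<sigma>_def using inj by (intro bij_betw_inv_into) (simp add: bij_betw_def)
  then have "bij_betw \<sigma> {j. enat j < n} J" by (simp only: n)
  moreover have "w (\<sigma> j) \<le> w (\<sigma> i)" if ij: "i \<le> j" "enat j < n" for i j
  \<comment> \<open>A strictly heavier \<open>\<sigma> j\<close> would come before
    \<open>\<sigma> i\<close>, forcing \<open>j < i\<close>.\<close>
  proof (rule ccontr)
    have "enat i < n" using ij by (meson enat_ord_simps(1) le_less_trans)
    then have "i \<in> rank ` J" "j \<in> rank ` J" using ij n by auto
    then have "\<sigma> i \<in> J" "\<sigma> j \<in> J" "rank (\<sigma> i) = i" "rank (\<sigma> j) = j"
      by (simp_all only: \<sigma>_def inv_into_into f_inv_into_f)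
    moreover assume "\<not> w (\<sigma> j) \<le> w (\<sigma> i)"
    ultimately show False
      using rank_less[of "\<sigma> j" "\<sigma> i"] ij by (auto simp: before_def)
  qed
  ultimately show ?thesis by (intro that) auto
qed


section \<open>Square summability under matching of coordinates\<close>

lemma ell2_has_sum_iff:
  "((\<lambda>j. (a j)\<^sup>2) has_sum s) UNIV \<longleftrightarrow> a \<in> ell2 \<and> (ell2_norm a)\<^sup>2 = s"
proof -
  have norm: "(ell2_norm a)\<^sup>2 = (\<Sum>j. (a j)\<^sup>2)" if "summable (\<lambda>j. (a j)\<^sup>2)"
    unfolding ell2_norm_def by (intro real_sqrt_pow2 suminf_nonneg that) simp
  \<comment> \<open>For nonnegative terms, convergence of the series is unconditional. Unconditional
    sums can be reindexed along bijections and also make sense over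
    \<open>nat + nat\<close>.\<close>
  have "((\<lambda>j. (a j)\<^sup>2) has_sum s) UNIV \<longleftrightarrow> (\<lambda>j. (a j)\<^sup>2) sums s"
    using has_sum_imp_sums sums_nonneg_imp_has_sum[of "\<lambda>j. (a j)\<^sup>2"] by auto
  with norm show ?thesis by (auto simp: ell2_def sums_iff)
qed

lemma ell2_diff:
  assumes "a \<in> ell2" "b \<in> ell2"
  shows "a - b \<in> ell2"
proof -
  have "summable (\<lambda>j. 2 * (a j)\<^sup>2 + 2 * (b j)\<^sup>2)"
    using assms by (intro summable_add summable_mult) (simp_all add: ell2_def)
  moreover have "(r - s)\<^sup>2 \<le> 2 * r\<^sup>2 + 2 * s\<^sup>2" for r s :: real
    using zero_le_power2[of "r + s"] by (simp add: power2_sum power2_diff)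
  ultimately show ?thesis
    unfolding ell2_def by (auto intro: summable_comparison_test')
qed

text \<open>Split the index type into its two ranges: subfamilies of a summable family are summable,
  and uniqueness of the sum identifies the total.\<close>

lemma pair_coords_has_sum_iff:
  "((\<lambda>i. (pair_coords (a, b) i)\<^sup>2) has_sum s) UNIV \<longleftrightarrow>
     a \<in> ell2 \<and> b \<in> ell2 \<and> (ell2_norm a)\<^sup>2 + (ell2_norm b)\<^sup>2 = s"
  (is "(?f has_sum s) UNIV \<longleftrightarrow> ?rhs")
proof -
  have l: "(?f has_sum t) (range Inl) \<longleftrightarrow> a \<in> ell2 \<and> (ell2_norm a)\<^sup>2 = t" for t
    by (subst has_sum_reindex) (simp_all add: o_def pair_coords_def ell2_has_sum_iff)
  have r: "(?f has_sum t) (range Inr) \<longleftrightarrow> b \<in> ell2 \<and> (ell2_norm b)\<^sup>2 = t" for t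
    by (subst has_sum_reindex) (simp_all add: o_def pair_coords_def ell2_has_sum_iff)
  have sum: "(?f has_sum (t + t')) UNIV"
    if "(?f has_sum t) (range Inl)" "(?f has_sum t') (range Inr)" for t t'
    using has_sum_Un_disjoint[OF that] by (auto simp: UNIV_sum)
  show ?thesis
  proof
    assume f: "(?f has_sum s) UNIV"
    then have "?f summable_on range Inl" "?f summable_on range Inr"
      by (auto intro: summable_on_subset_banach dest: has_sum_imp_summable)
    then have "a \<in> ell2" "b \<in> ell2" by (auto simp: summable_on_def l r)
    with l r sum has_sum_unique[OF f] show ?rhs by metis
  qed (use l r sum in blast)
qed

lemma has_sum_matched_coords:
  fixes f :: "'i \<Rightarrow> real" and g :: "'j \<Rightarrow> real"
  assumes "bij_betw \<sigma> A J" and "\<And>i. i \<in> A \<Longrightarrow> f i = g (\<sigma> i)"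
    and "\<And>i. i \<notin> A \<Longrightarrow> f i = 0" and "\<And>j. j \<notin> J \<Longrightarrow> g j = 0"
  shows "((\<lambda>i. (f i)\<^sup>2) has_sum s) UNIV \<longleftrightarrow> ((\<lambda>j. (g j)\<^sup>2) has_sum s) UNIV"
proof -
  have "((\<lambda>i. (f i)\<^sup>2) has_sum s) UNIV \<longleftrightarrow> ((\<lambda>i. (g (\<sigma> i))\<^sup>2) has_sum s) A"
    by (rule has_sum_cong_neutral) (use assms in auto)
  also have "\<dots> \<longleftrightarrow> ((\<lambda>j. (g j)\<^sup>2) has_sum s) J"
    by (rule has_sum_reindex_bij_betw) fact
  also have "\<dots> \<longleftrightarrow> ((\<lambda>j. (g j)\<^sup>2) has_sum s) UNIV"
    by (rule has_sum_cong_neutral) (use assms in auto)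
  finally show ?thesis .
qed

lemma ell2_matched_coords:
  assumes "bij_betw \<sigma> A J" and "\<And>i. i \<in> A \<Longrightarrow> m i = pair_coords (a, b) (\<sigma> i)"
    and "\<And>i. i \<notin> A \<Longrightarrow> m i = 0" and "\<And>j. j \<notin> J \<Longrightarrow> pair_coords (a, b) j = 0"
  shows "m \<in> ell2 \<longleftrightarrow> (a, b) \<in> ell2 \<times> ell2"
    and "m \<in> ell2 \<Longrightarrow> (ell2_norm m)\<^sup>2 = (ell2_norm a)\<^sup>2 + (ell2_norm b)\<^sup>2"
proof -
  \<comment> \<open>The equivalence for every \<open>s\<close> carries both membership and value:
    each side holds for some \<open>s\<close> exactly when it describes square summable data, and
    that \<open>s\<close> is then unique.\<close>
  have eq: "m \<in> ell2 \<and> (ell2_norm m)\<^sup>2 = s \<longleftrightarrow>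
      a \<in> ell2 \<and> b \<in> ell2 \<and> (ell2_norm a)\<^sup>2 + (ell2_norm b)\<^sup>2 = s" for s
    unfolding ell2_has_sum_iff[symmetric] pair_coords_has_sum_iff[symmetric]
    by (rule has_sum_matched_coords[where \<sigma> = \<sigma> and A = A and J = J]) (fact assms)+
  show "m \<in> ell2 \<longleftrightarrow> (a, b) \<in> ell2 \<times> ell2" using eq by blast
  show "(ell2_norm m)\<^sup>2 = (ell2_norm a)\<^sup>2 + (ell2_norm b)\<^sup>2" if "m \<in> ell2"
    using eq that by metis
qed

text \<open>The sets \<open>A\<close> and \<open>J\<close> may still contain coordinates that vanish
  identically; \<open>\<sigma>\<close> restricts to a bijection of the others because matched
  coordinates agree at every point.\<close>

lemma same_nonzero_coords_matched:
  assumes "bij_betw \<sigma> A J" and "\<And>x i. i \<in> A \<Longrightarrow> f x i = g x (\<sigma> i)"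
    and "\<And>x i. i \<notin> A \<Longrightarrow> f x i = 0" and "\<And>x j. j \<notin> J \<Longrightarrow> g x j = 0"
  shows "same_nonzero_coords f g"
  unfolding same_nonzero_coords_def
proof (intro exI conjI)
  have "{i. \<exists>x. f x i \<noteq> 0} \<subseteq> A" using assms(3) by blast
  moreover have "\<sigma> ` {i. \<exists>x. f x i \<noteq> 0} = {j. \<exists>x. g x j \<noteq> 0}"
  proof safe
    fix i x assume "f x i \<noteq> 0"
    then show "\<exists>x. g x (\<sigma> i) \<noteq> 0" using assms(2,3) by metis
  next
    fix j x assume j: "g x j \<noteq> 0"
    then obtain i where "i \<in> A" "j = \<sigma> i"
      using assms(1,4) by (metis bij_betw_imp_surj_on imageE)
    with j assms(2) show "j \<in> \<sigma> ` {i. \<exists>x. f x i \<noteq> 0}" by force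
  qed
  ultimately show "bij_betw \<sigma> {i. \<exists>x. f x i \<noteq> 0} {j. \<exists>x. g x j \<noteq> 0}"
    by (rule bij_betw_subset[OF assms(1)])
  show "\<forall>i. (\<exists>x. f x i \<noteq> 0) \<longrightarrow> (\<forall>x. g x (\<sigma> i) = f x i)"
  proof (intro allI impI)
    fix i y assume "\<exists>x. f x i \<noteq> 0"
    then have "i \<in> A" using assms(3) by blast
    then show "g y (\<sigma> i) = f y i" by (rule assms(2)[symmetric])
  qed
qed

subsection \<open>Merging of eigensystems\<close>

text \<open>Separates the ordering from the analysis: the spectral facts are checked for a family
  over an arbitrary index set \<open>J\<close> and then transported along
  \<open>\<sigma>\<close>.\<close>

lemma positive_eigensystem_enumerated:
  assumes bij: "bij_betw \<sigma> {j. enat j < n} J"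
    and mono: "\<forall>i j. i \<le> j \<and> enat j < n \<longrightarrow> w (\<sigma> j) \<le> w (\<sigma> i)"
    and pos: "\<And>a. a \<in> J \<Longrightarrow> 0 < w a"
    and cont: "\<And>a. a \<in> J \<Longrightarrow> continuous_on UNIV (v a)"
    and eig: "\<And>a. a \<in> J \<Longrightarrow> v a \<in> T_eigenspace \<mu> (w a)"
    and on: "\<And>a b. a \<in> J \<Longrightarrow> b \<in> J \<Longrightarrow> (\<integral>x. v a x * v b x \<partial>\<mu>) = (if a = b then 1 else 0)"
    and span: "\<And>c g. 0 < c \<Longrightarrow> g \<in> T_eigenspace \<mu> c \<Longrightarrow>
      \<exists>F k. finite F \<and> F \<subseteq> {a \<in> J. w a = c} \<and> (AE x in \<mu>. g x = (\<Sum>a\<in>F. k a * v a x))"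
  shows "positive_eigensystem \<mu> n (\<lambda>j. w (\<sigma> j)) (\<lambda>j. v (\<sigma> j))"
proof -
  have J: "\<sigma> j \<in> J" if "enat j < n" for j
    using bij_betwE[OF bij] that by blast
  have inj: "\<sigma> i = \<sigma> j \<longleftrightarrow> i = j" if "enat i < n" "enat j < n" for i j
    using bij_betw_imp_inj_on[OF bij] that by (auto dest: inj_onD)
  have span': "\<exists>F k. finite F \<and> F \<subseteq> {j. enat j < n \<and> w (\<sigma> j) = c} \<and>
      (AE x in \<mu>. g x = (\<Sum>j\<in>F. k j * v (\<sigma> j) x))"
    if cg: "0 < c" "g \<in> T_eigenspace \<mu> c" for c g
  proof -
    obtain F k where F: "finite F" "F \<subseteq> {a \<in> J. w a = c}" "AE x in \<mu>. g x = (\<Sum>a\<in>F. k a * v a x)"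
      using span[OF cg] by blast
    \<comment> \<open>The preimage of \<open>F\<close>; as \<open>\<sigma>\<close> reaches all of
      \<open>J\<close>, it maps \<open>F'\<close> bijectively onto \<open>F\<close>.\<close>
    define F' where "F' = {j. enat j < n \<and> \<sigma> j \<in> F}"
    have "F \<subseteq> \<sigma> ` {j. enat j < n}" using F(2) bij_betw_imp_surj_on[OF bij] by auto
    then have "\<sigma> ` F' = F" by (auto simp: F'_def)
    then have b: "bij_betw \<sigma> F' F" by (intro bij_betw_subset[OF bij]) (auto simp: F'_def)
    have "(\<Sum>j\<in>F'. k (\<sigma> j) * v (\<sigma> j) x) = (\<Sum>a\<in>F. k a * v a x)" for x
      by (rule sum.reindex_bij_betw[OF b])
    then have "AE x in \<mu>. g x = (\<Sum>j\<in>F'. k (\<sigma> j) * v (\<sigma> j) x)" using F(3) by simp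
    moreover have "finite F'" using bij_betw_finite[OF b] F(1) by simp
    moreover have "F' \<subseteq> {j. enat j < n \<and> w (\<sigma> j) = c}" using F(2) by (auto simp: F'_def)
    ultimately show ?thesis by (intro exI[of _ F'] exI[of _ "\<lambda>j. k (\<sigma> j)"] conjI)
  qed
  show ?thesis
    unfolding positive_eigensystem_def
  proof (intro conjI allI impI ballI)
    fix i j :: nat
    assume "enat i < n \<and> enat j < n"
    then show "(\<integral>x. v (\<sigma> i) x * v (\<sigma> j) x \<partial>\<mu>) = (if i = j then 1 else 0)"
      using on[of "\<sigma> i" "\<sigma> j"] J inj by auto
  qed (use J pos cont eig mono span' in auto)
qed

context fourth_moment_pair
begin

lemma merged_eigensystem:
  assumes sys1: "positive_eigensystem \<mu>1 n1 l1 u1" and sys2: "positive_eigensystem \<mu>2 n2 l2 u2"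
  defines "J \<equiv> {i. enat i < n1} <+> {i. enat i < n2}"
    and "w \<equiv> case_sum l1 l2"
    and "v \<equiv> case_sum (\<lambda>i z. u1 i (fst z)) (\<lambda>i z. u2 i (snd z))"
  obtains n \<sigma> where "bij_betw \<sigma> {j. enat j < n} J"
    and "positive_eigensystem (\<mu>1 \<Otimes>\<^sub>M \<mu>2) n (\<lambda>j. w (\<sigma> j)) (\<lambda>j. v (\<sigma> j))"
proof -
  note D1 = positive_eigensystemD[OF sys1] and D2 = positive_eigensystemD[OF sys2]
  have pos: "0 < w a" if "a \<in> J" for a
    using that D1(1) D2(1) by (auto simp: J_def w_def)
  have fin: "finite {a \<in> J. c \<le> w a}" if "c > 0" for c
  proof -
    have "{a \<in> J. c \<le> w a} = {i. enat i < n1 \<and> c \<le> l1 i} <+> {i. enat i < n2 \<and> c \<le> l2 i}"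
      by (auto simp: J_def w_def)
    then show ?thesis
      using A.finite_large_eigenvalues[OF sys1 that] B.finite_large_eigenvalues[OF sys2 that] by simp
  qed
  obtain n \<sigma> where bij: "bij_betw \<sigma> {j. enat j < n} J"
    and mono: "\<forall>i j. i \<le> j \<and> enat j < n \<longrightarrow> w (\<sigma> j) \<le> w (\<sigma> i)"
    by (rule enumerate_by_weight[of J w, OF pos fin])
  have L1: "u1 i \<in> L2 \<mu>1" "(\<integral>x. u1 i x \<partial>\<mu>1) = 0" if "enat i < n1" for i
    using D1(3)[OF that] A.eigenfunction_mean_zero[OF D1(3)[OF that]] D1(1)[OF that]
    by (auto simp: T_eigenspace_def)
  have L2: "u2 i \<in> L2 \<mu>2" "(\<integral>x. u2 i x \<partial>\<mu>2) = 0" if "enat i < n2" for i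
    using D2(3)[OF that] B.eigenfunction_mean_zero[OF D2(3)[OF that]] D2(1)[OF that]
    by (auto simp: T_eigenspace_def)
  have "positive_eigensystem (\<mu>1 \<Otimes>\<^sub>M \<mu>2) n (\<lambda>j. w (\<sigma> j)) (\<lambda>j. v (\<sigma> j))"
  proof (rule positive_eigensystem_enumerated[OF bij mono pos])
    fix a assume a: "a \<in> J"
    show "continuous_on UNIV (v a)"
    proof (cases a)
      case (Inl i)
      then have "continuous_on UNIV (u1 i)" using a D1(2) by (auto simp: J_def)
      then have "continuous_on UNIV (\<lambda>z :: 'a \<times> 'b. u1 i (fst z))"
        by (rule continuous_on_compose2[OF _ continuous_on_fst[OF continuous_on_id]]) simp
      then show ?thesis using Inl by (simp add: v_def)
    next
      case (Inr i)
      then have "continuous_on UNIV (u2 i)" using a D2(2) by (auto simp: J_def)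
      then have "continuous_on UNIV (\<lambda>z :: 'a \<times> 'b. u2 i (snd z))"
        by (rule continuous_on_compose2[OF _ continuous_on_snd[OF continuous_on_id]]) simp
      then show ?thesis using Inr by (simp add: v_def)
    qed
    show "v a \<in> T_eigenspace (\<mu>1 \<Otimes>\<^sub>M \<mu>2) (w a)"
      using a eigenfunction_comp_fst[OF D1(3)] eigenfunction_comp_snd[OF D2(3)]
      by (auto simp: J_def v_def w_def)
    fix b assume b: "b \<in> J"
    \<comment> \<open>Eigenfunctions of different factors are orthogonal even for equal eigenvalues,
      because the integral factors into two means that vanish.\<close>
    have cross: "(\<integral>z. u1 i (fst z) * u2 j (snd z) \<partial>(\<mu>1 \<Otimes>\<^sub>M \<mu>2)) = 0"
      if "enat i < n1" "enat j < n2" for i j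
      using integral_tensor[of "u1 i" "u2 j"] L1[OF that(1)] L2[OF that(2)]
      by (simp add: A.L2_integrable B.L2_integrable)
    have fst: "(\<integral>z. u1 i (fst z) * u1 j (fst z) \<partial>(\<mu>1 \<Otimes>\<^sub>M \<mu>2)) = (if i = j then 1 else 0)"
      if "enat i < n1" "enat j < n1" for i j
      using integral_comp_fst[of "\<lambda>x. u1 i x * u1 j x"] D1(4)[OF that]
        L2_mult_integrable[OF L1(1) L1(1), OF that] by simp
    have snd: "(\<integral>z. u2 i (snd z) * u2 j (snd z) \<partial>(\<mu>1 \<Otimes>\<^sub>M \<mu>2)) = (if i = j then 1 else 0)"
      if "enat i < n2" "enat j < n2" for i j
      using integral_comp_snd[of "\<lambda>x. u2 i x * u2 j x"] D2(4)[OF that]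
        L2_mult_integrable[OF L2(1) L2(1), OF that] by simp
    show "(\<integral>z. v a z * v b z \<partial>(\<mu>1 \<Otimes>\<^sub>M \<mu>2)) = (if a = b then 1 else 0)"
    proof (cases a; cases b)
      fix i j assume "a = Inl i" "b = Inl j"
      then show ?thesis using a b fst[of i j] by (auto simp: J_def v_def)
    next
      fix i j assume "a = Inl i" "b = Inr j"
      then show ?thesis using a b cross[of i j] by (auto simp: J_def v_def)
    next
      fix j i assume "a = Inr j" "b = Inl i"
      then show ?thesis using a b cross[of i j] by (auto simp: J_def v_def mult.commute)
    next
      fix i j assume "a = Inr i" "b = Inr j"
      then show ?thesis using a b snd[of i j] by (auto simp: J_def v_def)
    qed
  next
    fix c :: real and g
    assume c: "0 < c" and g: "g \<in> T_eigenspace (\<mu>1 \<Otimes>\<^sub>M \<mu>2) c"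
    \<comment> \<open>Expand each marginal in the eigenfunctions of its own factor; the disjoint sum
      of the two finite index sets then expands \<open>g\<close>.\<close>
    note dec = eigenfunction_decomposition[OF g less_imp_neq[OF c, symmetric]]
    obtain F k where F: "finite F" "F \<subseteq> {j. enat j < n1 \<and> l1 j = c}"
      "AE x in \<mu>1. marginal1 g x = (\<Sum>j\<in>F. k j * u1 j x)"
      using D1(5)[OF c dec(1)] by blast
    obtain G h where G: "finite G" "G \<subseteq> {j. enat j < n2 \<and> l2 j = c}"
      "AE x in \<mu>2. marginal2 g x = (\<Sum>j\<in>G. h j * u2 j x)"
      using D2(5)[OF c dec(2)] by blast
    have "AE z in \<mu>1 \<Otimes>\<^sub>M \<mu>2. g z = (\<Sum>a\<in>F <+> G. case_sum k h a * v a z)"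
      using dec(3) AE_fst[OF F(3)] AE_snd[OF G(3)]
      by eventually_elim (simp add: sum.Plus F(1) G(1) v_def)
    moreover have "finite (F <+> G)" "F <+> G \<subseteq> {a \<in> J. w a = c}"
      using F G by (auto simp: J_def w_def)
    ultimately show "\<exists>F k. finite F \<and> F \<subseteq> {a \<in> J. w a = c} \<and>
        (AE z in \<mu>1 \<Otimes>\<^sub>M \<mu>2. g z = (\<Sum>a\<in>F. k a * v a z))"
      by blast
  qed
  with bij show ?thesis by (rule that)
qed

end

theorem proposition6p2:
  fixes \<mu>1 :: "'a::polish_space measure"
    and \<mu>2 :: "'b::polish_space measure"
    and M1 :: "'a \<Rightarrow> nat \<Rightarrow> real"
    and M2 :: "'b \<Rightarrow> nat \<Rightarrow> real"
  assumes "prob_space \<mu>1" and "sets \<mu>1 = sets borel" and "finite_fourth_moment \<mu>1"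
    and "prob_space \<mu>2" and "sets \<mu>2 = sets borel" and "finite_fourth_moment \<mu>2"
    and "is_mds_map \<mu>1 M1" and "is_mds_map \<mu>2 M2"
  shows "\<exists>M :: 'a \<times> 'b \<Rightarrow> nat \<Rightarrow> real.
      is_mds_map (\<mu>1 \<Otimes>\<^sub>M \<mu>2) M \<and>
      same_nonzero_coords M (\<lambda>x. pair_coords (M1 (fst x), M2 (snd x))) \<and>
      (\<forall>x. M x \<in> ell2 \<longleftrightarrow> (M1 (fst x), M2 (snd x)) \<in> ell2 \<times> ell2) \<and>
      (\<forall>x y. M x \<in> ell2 \<and> M y \<in> ell2 \<longrightarrow>
         (ell2_norm (M x - M y))\<^sup>2 =
           (ell2_prod_norm (M1 (fst x) - M1 (fst y), M2 (snd x) - M2 (snd y)))\<^sup>2 \<and>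
         (ell2_norm (M x - M y))\<^sup>2 =
           (ell2_norm (M1 (fst x) - M1 (fst y)))\<^sup>2 + (ell2_norm (M2 (snd x) - M2 (snd y)))\<^sup>2)"
proof -
  interpret fourth_moment_pair \<mu>1 \<mu>2
    using assms(1-6)
    by (simp add: fourth_moment_pair_def fourth_moment_space_def fourth_moment_space_axioms_def)
  obtain n1 l1 u1 where sys1: "positive_eigensystem \<mu>1 n1 l1 u1"
    and M1: "M1 = (\<lambda>x j. if enat j < n1 then sqrt (l1 j) * u1 j x else 0)"
    using assms(7) unfolding is_mds_map_def by blast
  obtain n2 l2 u2 where sys2: "positive_eigensystem \<mu>2 n2 l2 u2"
    and M2: "M2 = (\<lambda>x j. if enat j < n2 then sqrt (l2 j) * u2 j x else 0)"
    using assms(8) unfolding is_mds_map_def by blast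
  define J where "J = {i. enat i < n1} <+> {i. enat i < n2}"
  define w where "w = case_sum l1 l2"
  define v where "v = case_sum (\<lambda>i z. u1 i (fst z :: 'a)) (\<lambda>i z. u2 i (snd z :: 'b))"
  obtain n \<sigma> where bij: "bij_betw \<sigma> {j. enat j < n} J"
    and sys: "positive_eigensystem (\<mu>1 \<Otimes>\<^sub>M \<mu>2) n (\<lambda>j. w (\<sigma> j)) (\<lambda>j. v (\<sigma> j))"
    by (rule merged_eigensystem[OF sys1 sys2, folded J_def w_def v_def])
  define M where "M x j = (if enat j < n then sqrt (w (\<sigma> j)) * v (\<sigma> j) x else 0)" for x j
  let ?p = "\<lambda>x. pair_coords (M1 (fst x), M2 (snd x))"
  have p_in: "?p x a = sqrt (w a) * v a x" if "a \<in> J" for x a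
    using that by (auto simp: J_def pair_coords_def M1 M2 w_def v_def)
  \<comment> \<open>Outside \<open>J\<close> lie exactly the padding zeros of \<open>M1\<close> and
    \<open>M2\<close>.\<close>
  have p_out: "?p x a = 0" if "a \<notin> J" for x a
    using that by (cases a) (auto simp: J_def pair_coords_def M1 M2)
  have M_in: "M x j = ?p x (\<sigma> j)" if "j \<in> {j. enat j < n}" for x j
    using that p_in bij_betwE[OF bij] by (auto simp: M_def)
  have M_out: "M x j = 0" if "j \<notin> {j. enat j < n}" for x j
    using that by (simp add: M_def)
  \<comment> \<open>Matching is linear in the coordinates, so \<open>M x - M y\<close> is matched
    with the pair of differences by the same \<open>\<sigma>\<close>, and the norm identity for
    single points applies to it.\<close>
  have pair_diff: "pair_coords (a - a', b - b') i = pair_coords (a, b) i - pair_coords (a', b') i"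
    for a a' b b' i
    by (cases i) (simp_all add: pair_coords_def)
  have "is_mds_map (\<mu>1 \<Otimes>\<^sub>M \<mu>2) M"
    unfolding is_mds_map_def using sys M_def by blast
  moreover have "same_nonzero_coords M ?p"
    by (rule same_nonzero_coords_matched[OF bij]) (fact M_in M_out p_out)+
  moreover have mem: "M x \<in> ell2 \<longleftrightarrow> (M1 (fst x), M2 (snd x)) \<in> ell2 \<times> ell2" for x
    by (rule ell2_matched_coords(1)[OF bij]) (fact M_in M_out p_out)+
  moreover have norm: "(ell2_norm (M x - M y))\<^sup>2 =
      (ell2_norm (M1 (fst x) - M1 (fst y)))\<^sup>2 + (ell2_norm (M2 (snd x) - M2 (snd y)))\<^sup>2"
    if "M x \<in> ell2" "M y \<in> ell2" for x y
  proof (rule ell2_matched_coords(2)[OF bij])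
    show "M x - M y \<in> ell2"
      using that by (rule ell2_diff)
  qed (use M_in M_out p_out in \<open>simp_all add: pair_diff\<close>)
  ultimately show ?thesis
    by (intro exI[of _ M]) (simp add: ell2_prod_norm_def)
qed

end
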